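(* Let $k$ be a positive integer. Then for all sufficiently large $n$ (with a threshold that may depend on $k$), $$R(P_n,kK_2,kK_2)=n+2k-2.$$
   Context: All graphs are finite, simple and undirected. $P_n$ denotes the path on $n$ vertices and $kK_2$ the disjoint union of $k$ edges (a matching of size $k$). For graphs $G_1,\ldots,G_r$, the multicolor Ramsey number $R(G_1,\ldots,G_r)$ is the smallest integer $n$ such that every coloring of the edges of the complete graph $K_n$ with $r$ colors contains a monochromatic copy of $G_i$ in color $i$ for some $1\le i\le r$ (a copy means a not necessarily induced subgraph). *)

theory Defs
  imports "HOL-Library.Ramsey"
begin

record 'a ugraph =
  uverts :: "'a set"
  uedges :: "'a set set"

definition simple_graph :: "'a ugraph \<Rightarrow> bool" where
  "simple_graph G \<longleftrightarrow> finite (uverts G) \<and> uedges G \<subseteq> nsets (uverts G) 2"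

definition complete_graph :: "nat \<Rightarrow> nat ugraph" where
  "complete_graph n = \<lparr>uverts = {..<n}, uedges = nsets {..<n} 2\<rparr>"

definition path_graph :: "nat \<Rightarrow> nat ugraph" where
  "path_graph n = \<lparr>uverts = {..<n}, uedges = {{i, Suc i} | i. Suc i < n}\<rparr>"

definition matching_graph :: "nat \<Rightarrow> nat ugraph" where
  "matching_graph k =
    \<lparr>uverts = {..<2 * k}, uedges = {{2 * i, 2 * i + 1} | i. i < k}\<rparr>"

text \<open>\<open>contains_copy H G\<close>: \<open>H\<close> has a not necessarily induced subgraph isomorphic to \<open>G\<close>.\<close>

definition contains_copy :: "'a ugraph \<Rightarrow> 'b ugraph \<Rightarrow> bool" where
  "contains_copy H G \<longleftrightarrow>
    (\<exists>f. inj_on f (uverts G) \<and> f ` uverts G \<subseteq> uverts H \<and> (\<forall>e\<in>uedges G. f ` e \<in> uedges H))"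

definition colour_class :: "'a ugraph \<Rightarrow> ('a set \<Rightarrow> nat) \<Rightarrow> nat \<Rightarrow> 'a ugraph" where
  "colour_class H c i = \<lparr>uverts = uverts H, uedges = {e \<in> uedges H. c e = i}\<rparr>"

definition ramsey_arrow :: "nat \<Rightarrow> 'a ugraph list \<Rightarrow> bool" where
  "ramsey_arrow n Gs \<longleftrightarrow>
    (\<forall>c \<in> uedges (complete_graph n) \<rightarrow> {..<length Gs}.
      \<exists>i<length Gs. contains_copy (colour_class (complete_graph n) c i) (Gs ! i))"

definition ramsey_number :: "'a ugraph list \<Rightarrow> nat" where
  "ramsey_number Gs = (LEAST n. ramsey_arrow n Gs)"

lemma simple_graph_path_graph: "simple_graph (path_graph n)"
  by (auto simp: simple_graph_def path_graph_def nsets_def)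

lemma simple_graph_matching_graph: "simple_graph (matching_graph k)"
  by (auto simp: simple_graph_def matching_graph_def nsets_def)

text \<open>By Ramsey's theorem the minimum in \<open>ramsey_number\<close> is over a nonempty set.\<close>

lemma ramsey_arrow_ramsey_number:
  assumes "\<And>G. G \<in> set Gs \<Longrightarrow> simple_graph G"
  shows "ramsey_arrow (ramsey_number Gs) Gs"
proof -
  obtain N :: nat where N: "partn_lst {..<N} (map (\<lambda>G. card (uverts G)) Gs) 2"
    using ramsey_full by blast
  have "ramsey_arrow N Gs"
    unfolding ramsey_arrow_def
  proof
    fix c assume "c \<in> uedges (complete_graph N) \<rightarrow> {..<length Gs}"
    then have c: "c \<in> nsets {..<N} 2 \<rightarrow> {..<length Gs}"
      by (simp add: complete_graph_def)
    obtain i H where i: "i < length Gs"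
      and H: "H \<in> nsets {..<N} (card (uverts (Gs ! i)))"
      and mono: "c ` nsets H 2 \<subseteq> {i}"
      using N c unfolding partn_lst_def monochromatic_def by fastforce
    have G: "simple_graph (Gs ! i)" using assms i by simp
    have fin: "finite (uverts (Gs ! i))" using G by (simp add: simple_graph_def)
    have HN: "H \<subseteq> {..<N}" "finite H" "card H = card (uverts (Gs ! i))"
      using H by (auto simp: nsets_def)
    obtain f where f: "bij_betw f (uverts (Gs ! i)) H"
      using finite_same_card_bij[OF fin HN(2)] HN(3) by metis
    have inj: "inj_on f (uverts (Gs ! i))" and im: "f ` uverts (Gs ! i) = H"
      using f by (auto simp: bij_betw_def)
    have "f ` e \<in> nsets {..<N} 2 \<and> c (f ` e) = i" if e: "e \<in> uedges (Gs ! i)" for e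
    proof -
      have e': "e \<subseteq> uverts (Gs ! i)" "finite e" "card e = 2"
        using G e by (auto simp: simple_graph_def nsets_def)
      have "card (f ` e) = 2"
        using e' card_image inj inj_on_subset by metis
      then have "f ` e \<in> nsets H 2"
        using e' im by (auto simp: nsets_def)
      then show ?thesis using mono HN(1) by (auto simp: nsets_def)
    qed
    then have "contains_copy (colour_class (complete_graph N) c i) (Gs ! i)"
      unfolding contains_copy_def colour_class_def complete_graph_def
      using inj im HN(1) by (intro exI[of _ f]) auto
    with i show "\<exists>i<length Gs. contains_copy (colour_class (complete_graph N) c i) (Gs ! i)"
      by blast
  qed
  then show ?thesis unfolding ramsey_number_def by (rule LeastI)
qed

end

theory Submission
  imports Defs
begin

text \<open>
  Lower bound: colour a clique on \<open>n - 1\<close> vertices red (colour 0), then add \<open>k - 1\<close> vertices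
  all of whose edges are blue (colour 1) and \<open>k - 1\<close> vertices all of whose remaining edges are
  green (colour 2).  A red path stays inside the clique, and a blue or green matching uses up a
  different one of the \<open>k - 1\<close> special vertices with each edge.

  Upper bound: a graph without \<open>kK\<^sub>2\<close> has fewer than \<open>k\<close> vertices of degree at least
  \<open>2 * k\<close>, because \<open>k\<close> such vertices could be matched greedily (\<open>greedy_matching\<close>).  Hence
  at most \<open>2 * k - 2\<close> of the \<open>n + 2 * k - 2\<close> vertices have large blue or large green degree.
  On the at least \<open>n\<close> remaining vertices the red graph is almost complete: each vertex is
  joined in blue or green to fewer than \<open>4 * k\<close> others.  Since \<open>n\<close> is large compared with
  \<open>k\<close>, this red graph has paths of every order up to its number of vertices
  (\<open>almost_complete_path\<close>), in particular a \<open>P\<^sub>n\<close>.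
\<close>

section \<open>Obstructions to matchings and paths\<close>

text \<open>The edges of a matching are disjoint, so they meet the cover in different vertices.\<close>

lemma matching_le_card_cover:
  assumes copy: "contains_copy H (matching_graph k)"
    and cover: "\<And>e. e \<in> uedges H \<Longrightarrow> e \<inter> S \<noteq> {}" and fin: "finite S"
  shows "k \<le> card S"
proof -
  obtain f where inj: "inj_on f {..<2 * k}"
    and edges: "\<forall>e\<in>uedges (matching_graph k). f ` e \<in> uedges H"
    using copy by (auto simp: contains_copy_def matching_graph_def)
  have edge: "f ` {2 * i, 2 * i + 1} \<in> uedges H" if "i < k" for i
    by (rule edges[rule_format]) (use that in \<open>auto simp: matching_graph_def\<close>)
  have "\<exists>x\<in>{2 * i, 2 * i + 1}. f x \<in> S" if "i < k" for i
    using cover[OF edge[OF that]] by blast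
  then obtain s where s: "\<And>i. i < k \<Longrightarrow> s i \<in> {2 * i, 2 * i + 1} \<and> f (s i) \<in> S"
    by metis
  have s_lt: "s i < 2 * k" and s_div: "s i div 2 = i" if "i < k" for i
    using s[OF that] that by auto
  have "inj_on (\<lambda>i. f (s i)) {..<k}"
  proof (rule inj_onI)
    fix i j assume ij: "i \<in> {..<k}" "j \<in> {..<k}" "f (s i) = f (s j)"
    then have "s i = s j" using inj_onD[OF inj ij(3)] s_lt[of i] s_lt[of j] by blast
    then show "i = j" using s_div ij by (metis lessThan_iff)
  qed
  moreover have "(\<lambda>i. f (s i)) ` {..<k} \<subseteq> S" using s by blast
  ultimately have "card {..<k} \<le> card S"
    using fin by (rule card_inj_on_le)
  then show ?thesis by simp
qed

lemma path_le_card_span: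
  assumes copy: "contains_copy H (path_graph n)" and n: "2 \<le> n"
    and span: "\<And>e. e \<in> uedges H \<Longrightarrow> e \<subseteq> S" and fin: "finite S"
  shows "n \<le> card S"
proof -
  obtain f where inj: "inj_on f {..<n}"
    and edges: "\<forall>e\<in>uedges (path_graph n). f ` e \<in> uedges H"
    using copy by (auto simp: contains_copy_def path_graph_def)
  have edge: "f ` {i, Suc i} \<in> uedges H" if "Suc i < n" for i
    by (rule edges[rule_format]) (use that in \<open>auto simp: path_graph_def\<close>)
  have "f i \<in> S" if "i < n" for i
  proof (cases i)
    case 0
    then show ?thesis using span[OF edge[of 0]] n by auto
  next
    case (Suc j)
    then show ?thesis using span[OF edge[of j]] that by auto
  qed
  then have "f ` {..<n} \<subseteq> S" by blast
  with inj have "card {..<n} \<le> card S"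
    using fin by (rule card_inj_on_le)
  then show ?thesis by simp
qed

lemma ramsey_lower_bound:
  assumes n: "2 \<le> n" and k: "k > 0" and m: "m < n + 2 * k - 2"
  shows "\<not> ramsey_arrow m [path_graph n, matching_graph k, matching_graph k]"
proof
  assume arrow: "ramsey_arrow m [path_graph n, matching_graph k, matching_graph k]"
  \<comment> \<open>The red clique and the centres of the blue and of the green edges.  For the largest
    relevant \<open>m = n + 2 * k - 3\<close> these sets partition the vertices.\<close>
  define S0 S1 S2 where "S0 = {..<n - 1}" and "S1 = {n - 1..<n + k - 2}"
    and "S2 = {n + k - 2..<n + 2 * k - 3}"
  have cards: "card S0 = n - 1" "card S1 = k - 1" "card S2 = k - 1"
    using n k by (auto simp: S0_def S1_def S2_def)
  have fin: "finite S0" "finite S1" "finite S2"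
    by (simp_all add: S0_def S1_def S2_def)
  have all: "{..<m} \<subseteq> S0 \<union> S1 \<union> S2"
    using m n k by (auto simp: S0_def S1_def S2_def)
  define c :: "nat set \<Rightarrow> nat" where
    "c e = (if e \<subseteq> S0 then 0 else if e \<inter> S1 \<noteq> {} then 1 else 2)" for e
  define H where "H = colour_class (complete_graph m) c"
  have "c \<in> uedges (complete_graph m)
      \<rightarrow> {..<length [path_graph n, matching_graph k, matching_graph k]}"
    by (auto simp: c_def)
  from bspec[OF arrow[unfolded ramsey_arrow_def] this] obtain i where "i < 3"
    and i: "contains_copy (H i) ([path_graph n, matching_graph k, matching_graph k] ! i)"
    by (auto simp: H_def numeral_3_eq_3)
  have "i = 0 \<or> i = 1 \<or> i = 2" using \<open>i < 3\<close> by linarith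
  with i consider "contains_copy (H 0) (path_graph n)" | "contains_copy (H 1) (matching_graph k)"
    | "contains_copy (H 2) (matching_graph k)"
    by auto
  then show False
  proof cases
    case 1
    have "n \<le> card S0"
      by (rule path_le_card_span[OF 1 n _ fin(1)])
        (auto simp: H_def colour_class_def c_def split: if_splits)
    then show False using cards n by simp
  next
    case 2
    have "k \<le> card S1"
      by (rule matching_le_card_cover[OF 2 _ fin(2)])
        (auto simp: H_def colour_class_def c_def split: if_splits)
    then show False using cards k by simp
  next
    case 3
    have "e \<inter> S2 \<noteq> {}" if "e \<in> uedges (H 2)" for e
    proof -
      have "e \<subseteq> {..<m}" "\<not> e \<subseteq> S0" "e \<inter> S1 = {}"
        using that
        by (auto simp: H_def colour_class_def complete_graph_def nsets_def c_def split: if_splits)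
      then show ?thesis using all by blast
    qed
    then have "k \<le> card S2"
      by (rule matching_le_card_cover[OF 3 _ fin(3)])
    then show False using cards k by simp
  qed
qed

section \<open>Vertices of large degree yield a matching\<close>

text \<open>
  Partners for the vertices of \<open>A\<close> are chosen one at a time.  A vertex has at least
  \<open>2 * card A\<close> neighbours; fewer than that are excluded, namely \<open>A\<close> itself and the fewer than
  \<open>card A\<close> partners chosen before.
\<close>

lemma greedy_matching:
  fixes N :: "'a \<Rightarrow> 'a set"
  assumes "finite A" and deg: "\<And>v. v \<in> A \<Longrightarrow> 2 * card A \<le> card (N v)"
  shows "\<exists>b. inj_on b A \<and> (\<forall>v\<in>A. b v \<in> N v - A)"
proof -
  have "\<exists>b. inj_on b F \<and> (\<forall>v\<in>F. b v \<in> N v - A)" if "F \<subseteq> A" for F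
    using finite_subset[OF that \<open>finite A\<close>] that
  proof (induction F rule: finite_induct)
    case empty
    then show ?case by simp
  next
    case (insert v F)
    then obtain b where b: "inj_on b F" "\<forall>u\<in>F. b u \<in> N u - A" by auto
    have "card F < card A"
      using insert \<open>finite A\<close> by (intro psubset_card_mono) auto
    then have "card (A \<union> b ` F) < 2 * card A"
      using card_Un_le[of A "b ` F"] card_image_le[OF insert(1), of b] by linarith
    also have "\<dots> \<le> card (N v)" using deg insert by simp
    finally have "\<not> N v \<subseteq> A \<union> b ` F"
      using card_mono[of "A \<union> b ` F" "N v"] insert(1) \<open>finite A\<close> by auto
    then obtain w where w: "w \<in> N v" "w \<notin> A" "w \<notin> b ` F" by blast
    have "inj_on (b(v := w)) (insert v F)"
      using b(1) w insert(2) by (auto simp: inj_on_def)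
    moreover have "\<forall>u\<in>insert v F. (b(v := w)) u \<in> N u - A"
      using b(2) w by auto
    ultimately show ?case by blast
  qed
  then show ?thesis by blast
qed

lemma contains_matching_of_large_degrees:
  assumes finV: "finite (uverts H)" and AV: "A \<subseteq> uverts H"
    and deg: "\<And>v. v \<in> A \<Longrightarrow> 2 * card A \<le> card {u \<in> uverts H. {v, u} \<in> uedges H}"
  shows "contains_copy H (matching_graph (card A))"
proof -
  have finA: "finite A" using finV AV by (rule rev_finite_subset)
  obtain b where inj_b: "inj_on b A"
    and b: "\<And>v. v \<in> A \<Longrightarrow> b v \<in> uverts H \<and> {v, b v} \<in> uedges H \<and> b v \<notin> A"
    using greedy_matching[OF finA deg] by fastforce
  obtain a where a: "bij_betw a {..<card A} A"
    using ex_bij_betw_nat_finite[OF finA] by (auto simp: atLeast0LessThan)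
  have aA: "a i \<in> A" if "i < card A" for i
    using a that by (auto simp: bij_betw_def)
  have inj_a: "inj_on a {..<card A}" using a by (simp add: bij_betw_def)
  \<comment> \<open>Edge \<open>i\<close> of the matching goes to the \<open>i\<close>-th vertex of \<open>A\<close> and its partner.\<close>
  define f where "f x = (if even x then a (x div 2) else b (a (x div 2)))" for x
  have half: "x div 2 < card A" if "x < 2 * card A" for x using that by auto
  have "inj_on f {..<2 * card A}"
  proof (rule inj_onI)
    fix x y assume xy: "x \<in> {..<2 * card A}" "y \<in> {..<2 * card A}" and eq: "f x = f y"
    have X: "a (x div 2) \<in> A" "a (y div 2) \<in> A" using xy half aA by auto
    have par: "even x \<longleftrightarrow> even y"
      using eq X b unfolding f_def by (metis (full_types))
    then have "a (x div 2) = a (y div 2)"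
      using eq X inj_b unfolding f_def by (auto dest: inj_onD split: if_splits)
    then have "x div 2 = y div 2"
      using inj_a xy half by (auto dest: inj_onD)
    then show "x = y" using par by (metis even_two_times_div_two odd_two_times_div_two_succ)
  qed
  moreover have "f ` {..<2 * card A} \<subseteq> uverts H"
    using half aA b AV by (auto simp: f_def)
  moreover have "f ` {2 * i, 2 * i + 1} \<in> uedges H" if "i < card A" for i
    using b[OF aA[OF that]] by (simp add: f_def insert_commute)
  ultimately show ?thesis
    unfolding contains_copy_def matching_graph_def by (intro exI[of _ f]) auto
qed

lemma few_large_degrees_of_no_matching:
  assumes finV: "finite (uverts H)" and no: "\<not> contains_copy H (matching_graph k)"
  shows "card {v \<in> uverts H. 2 * k \<le> card {u \<in> uverts H. {v, u} \<in> uedges H}} < k"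
    (is "card ?B < k")
proof (rule ccontr)
  assume "\<not> card ?B < k"
  then have "k \<le> card ?B" by simp
  then obtain A where A: "A \<subseteq> ?B" and "card A = k"
    by (rule obtain_subset_with_card_n)
  have "A \<subseteq> uverts H" using A by blast
  moreover have "2 * card A \<le> card {u \<in> uverts H. {v, u} \<in> uedges H}" if "v \<in> A" for v
    using subsetD[OF A that] \<open>card A = k\<close> by simp
  ultimately have "contains_copy H (matching_graph (card A))"
    by (rule contains_matching_of_large_degrees[OF finV])
  then show False using no \<open>card A = k\<close> by simp
qed

section \<open>Paths in almost complete graphs\<close>

text \<open>
  Cut the list into consecutive pairs: if every pair contained an element of \<open>S\<close>, then at least
  half of the list (rounded down) would lie in \<open>S\<close>.
\<close>

lemma adjacent_pair_avoiding:
  assumes "2 * length (filter (\<lambda>x. x \<in> S) xs) + 2 \<le> length xs"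
  shows "\<exists>ys a b zs. xs = ys @ a # b # zs \<and> a \<notin> S \<and> b \<notin> S"
  using assms
proof (induction xs rule: induct_list012)
  case (3 a b xs)
  show ?case
  proof (cases "a \<notin> S \<and> b \<notin> S")
    case True
    then show ?thesis by (intro exI[of _ "[]"]) auto
  next
    case False
    then have "2 * length (filter (\<lambda>x. x \<in> S) xs) + 2 \<le> length xs"
      using "3.prems" by (auto split: if_splits)
    then obtain ys c d zs where "xs = ys @ c # d # zs" "c \<notin> S" "d \<notin> S"
      using "3.IH" by blast
    then show ?thesis by (intro exI[of _ "a # b # ys"]) auto
  qed
qed auto

text \<open>
  The path grows one vertex at a time.  While it is short, its end vertex still has a neighbour
  outside it.  Once it has at least \<open>2 * D + 2\<close> vertices, any vertex outside misses at most \<open>D\<close>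
  of them, hence is adjacent to two consecutive ones and can be inserted between them.  The
  bound on \<open>card W\<close> makes the two ranges meet.
\<close>

lemma almost_complete_path:
  assumes fin: "finite W" and sym: "\<And>u v. R u v \<Longrightarrow> R v u"
    and miss: "\<And>v. v \<in> W \<Longrightarrow> card {u \<in> W. \<not> R v u} \<le> D"
    and large: "3 * D + 2 \<le> card W"
    and "m \<le> card W"
  shows "\<exists>xs. distinct xs \<and> set xs \<subseteq> W \<and> length xs = m \<and> successively R xs"
  using \<open>m \<le> card W\<close>
proof (induction m)
  case 0
  then show ?case by simp
next
  case (Suc m)
  then obtain xs where xs: "distinct xs" "set xs \<subseteq> W" "length xs = m" "successively R xs"
    by auto
  have card_xs: "card (set xs) = m" using xs distinct_card by blast
  show ?case
  proof (cases "m < 2 * D + 2")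
    case True
    show ?thesis
    proof (cases "xs = []")
      case True
      obtain w where "w \<in> W" using Suc.prems by fastforce
      then show ?thesis using True xs by (intro exI[of _ "[w]"]) auto
    next
      case False
      then have "last xs \<in> W" using xs by auto
      then have "card (set xs \<union> {u \<in> W. \<not> R (last xs) u}) < card W"
        using card_Un_le[of "set xs" "{u \<in> W. \<not> R (last xs) u}"] miss card_xs large
          \<open>m < 2 * D + 2\<close> by fastforce
      then have "\<not> W \<subseteq> set xs \<union> {u \<in> W. \<not> R (last xs) u}"
        using fin card_mono[of "set xs \<union> {u \<in> W. \<not> R (last xs) u}" W] by auto
      then obtain w where w: "w \<in> W" "w \<notin> set xs" "R (last xs) w" by auto
      then show ?thesis using xs False
        by (intro exI[of _ "xs @ [w]"]) (auto simp: successively_append_iff)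
    qed
  next
    case False
    have "\<not> W \<subseteq> set xs"
      using Suc.prems card_xs card_mono[of "set xs" W] by auto
    then obtain w where w: "w \<in> W" "w \<notin> set xs" by blast
    have "length (filter (\<lambda>x. x \<in> {u \<in> W. \<not> R w u}) xs)
        = card (set xs \<inter> {u \<in> W. \<not> R w u})"
      using xs(1) by (metis distinct_card distinct_filter set_filter Int_def)
    also have "\<dots> \<le> card {u \<in> W. \<not> R w u}"
      using fin by (intro card_mono) auto
    also have "\<dots> \<le> D" using miss w by blast
    finally have "2 * length (filter (\<lambda>x. x \<in> {u \<in> W. \<not> R w u}) xs) + 2 \<le> length xs"
      using False xs(3) by linarith
    from adjacent_pair_avoiding[OF this] obtain ys a b zs where split: "xs = ys @ a # b # zs"
      and "a \<notin> {u \<in> W. \<not> R w u}" "b \<notin> {u \<in> W. \<not> R w u}"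
      by blast
    then have "R w a" "R w b" using xs(2) by auto
    then show ?thesis using xs w sym split
      by (intro exI[of _ "ys @ a # w # b # zs"]) (auto simp: successively_append_iff)
  qed
qed

lemma contains_path_of_list:
  assumes "distinct xs" "set xs \<subseteq> uverts H" "successively (\<lambda>u v. {u, v} \<in> uedges H) xs"
  shows "contains_copy H (path_graph (length xs))"
  unfolding contains_copy_def path_graph_def
  using assms
  by (intro exI[of _ "\<lambda>i. xs ! i"])
    (auto simp: inj_on_def nth_eq_iff_index_eq successively_conv_nth)

section \<open>The Ramsey number\<close>

text \<open>
  The red graph on the vertices of small blue and green degree satisfies
  \<open>almost_complete_path\<close> with \<open>D = 4 * k\<close>; the threshold on \<open>n\<close> is \<open>3 * D + 2\<close>.
\<close>

lemma ramsey_upper_bound: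
  assumes k: "k > 0" and n: "12 * k + 2 \<le> n"
  shows "ramsey_arrow (n + 2 * k - 2) [path_graph n, matching_graph k, matching_graph k]"
  unfolding ramsey_arrow_def
proof (intro ballI)
  let ?Gs = "[path_graph n, matching_graph k, matching_graph k]"
  define V where "V = {..<n + 2 * k - 2}"
  fix c assume "c \<in> uedges (complete_graph (n + 2 * k - 2)) \<rightarrow> {..<length ?Gs}"
  then have c: "c e < 3" if "e \<in> nsets V 2" for e
    using that by (auto simp: complete_graph_def V_def numeral_3_eq_3)
  define H where "H = colour_class (complete_graph (n + 2 * k - 2)) c"
  have verts: "uverts (H i) = V" and edges: "uedges (H i) = {e \<in> nsets V 2. c e = i}" for i
    by (simp_all add: H_def colour_class_def complete_graph_def V_def)
  have finV: "finite V" by (simp add: V_def)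
  define nbs where "nbs i v = {u \<in> V. {v, u} \<in> uedges (H i)}" for i v
  define B where "B i = {v \<in> V. 2 * k \<le> card (nbs i v)}" for i
  have "contains_copy (H 0) (path_graph n)"
    if no1: "\<not> contains_copy (H 1) (matching_graph k)"
      and no2: "\<not> contains_copy (H 2) (matching_graph k)"
  proof -
    define W where "W = V - (B 1 \<union> B 2)"
    have B1: "card (B 1) < k" and B2: "card (B 2) < k"
      using few_large_degrees_of_no_matching[OF _ no1] few_large_degrees_of_no_matching[OF _ no2]
      by (simp_all add: B_def nbs_def verts finV)
    have finW: "finite W" using finV by (simp add: W_def)
    have "card V - card (B 1 \<union> B 2) \<le> card W"
      unfolding W_def by (intro diff_card_le_card_Diff) (auto simp: B_def finV)
    moreover have "card (B 1 \<union> B 2) \<le> 2 * k - 2"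
      using card_Un_le[of "B 1" "B 2"] B1 B2 by linarith
    moreover have "card V = n + 2 * k - 2" by (simp add: V_def)
    ultimately have nW: "n \<le> card W" using k by linarith
    \<comment> \<open>A vertex misses itself, and at most \<open>2 * k - 1\<close> others for each of blue and green.\<close>
    have "card {u \<in> W. \<not> {v, u} \<in> uedges (H 0)} \<le> 4 * k" if v: "v \<in> W" for v
    proof -
      have "{u \<in> W. \<not> {v, u} \<in> uedges (H 0)} \<subseteq> insert v (nbs 1 v \<union> nbs 2 v)"
      proof
        fix u assume u: "u \<in> {u \<in> W. \<not> {v, u} \<in> uedges (H 0)}"
        show "u \<in> insert v (nbs 1 v \<union> nbs 2 v)"
        proof (cases "u = v")
          case False
          then have e: "{v, u} \<in> nsets V 2" using u v by (auto simp: nsets_def W_def)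
          with u have "c {v, u} = 1 \<or> c {v, u} = 2" using c[OF e] by (auto simp: edges)
          then show ?thesis using e u by (auto simp: nbs_def edges W_def)
        qed simp
      qed
      then have "card {u \<in> W. \<not> {v, u} \<in> uedges (H 0)} \<le> card (insert v (nbs 1 v \<union> nbs 2 v))"
        using finV by (intro card_mono) (auto simp: nbs_def)
      also have "\<dots> \<le> Suc (card (nbs 1 v) + card (nbs 2 v))"
        using card_Un_le[of "nbs 1 v" "nbs 2 v"] finV by (simp add: card_insert_if nbs_def)
      also have "\<dots> \<le> 4 * k" using v by (auto simp: W_def B_def)
      finally show ?thesis .
    qed
    then obtain xs where "distinct xs" "set xs \<subseteq> W" "length xs = n"
      "successively (\<lambda>u v. {u, v} \<in> uedges (H 0)) xs"
      using almost_complete_path[OF finW, of "\<lambda>u v. {u, v} \<in> uedges (H 0)" "4 * k" n] nW n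
      by (force simp: insert_commute)
    then show ?thesis
      using contains_path_of_list[of xs "H 0"] by (auto simp: verts W_def)
  qed
  then consider "contains_copy (H 0) (?Gs ! 0)" | "contains_copy (H 1) (?Gs ! 1)"
    | "contains_copy (H 2) (?Gs ! 2)" by fastforce
  then show "\<exists>i<length ?Gs.
      contains_copy (colour_class (complete_graph (n + 2 * k - 2)) c i) (?Gs ! i)"
    unfolding H_def
  proof cases
    case 1
    then show ?thesis by (intro exI[of _ 0]) simp
  next
    case 2
    then show ?thesis by (intro exI[of _ 1]) simp
  next
    case 3
    then show ?thesis by (intro exI[of _ 2]) simp
  qed
qed

theorem theorem18:
  fixes k :: nat
  assumes "k > 0"
  shows "\<exists>N. \<forall>n\<ge>N.
    ramsey_number [path_graph n, matching_graph k, matching_graph k] = n + 2 * k - 2"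
proof (intro exI allI impI)
  fix n assume n: "12 * k + 2 \<le> n"
  show "ramsey_number [path_graph n, matching_graph k, matching_graph k] = n + 2 * k - 2"
    unfolding ramsey_number_def
  proof (rule Least_equality)
    show "ramsey_arrow (n + 2 * k - 2) [path_graph n, matching_graph k, matching_graph k]"
      using ramsey_upper_bound assms n by blast
    have "2 \<le> n" using n by linarith
    then show "n + 2 * k - 2 \<le> m"
      if "ramsey_arrow m [path_graph n, matching_graph k, matching_graph k]" for m
      using ramsey_lower_bound[of n k m] that assms by (meson not_less)
  qed
qed

end
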